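(* Let $n\ge 2$ be an integer. The kernel of the symmetric Gauss-Epple action $\mathrm{symGE}$ of $B_n$ is equal to the kernel of the Gauss-Epple action $GE$ of $B_n$.
   Context: $[n]=\{1,\dots,n\}$; $\mathrm{Sym}(X)$ is the group of bijections of $X$ under composition. $B_n$ is the braid group on $n$ strands, with presentation by the Artin generators $\sigma_1,\dots,\sigma_{n-1}$ subject to $\sigma_i\sigma_{i+1}\sigma_i=\sigma_{i+1}\sigma_i\sigma_{i+1}$ for all $1\le i\le n-2$ and $\sigma_i\sigma_j=\sigma_j\sigma_i$ whenever $|i-j|>1$. The Gauss-Epple action is the left action, i.e. group homomorphism, $GE:B_n\to\mathrm{Sym}([n]\times\mathbb{Z})$ determined by: $GE(\sigma_k)(a,b)=(a,b)$ if $a\notin\{k,k+1\}$, $GE(\sigma_k)(k,b)=(k+1,b)$, $GE(\sigma_k)(k+1,b)=(k,b+1)$, for $1\le k\le n-1$. The symmetric Gauss-Epple action is the left action, i.e. group homomorphism, $\mathrm{symGE}:B_n\to\mathrm{Sym}(\mathbb{Z}^2)$ determined by: $\mathrm{symGE}(\sigma_k)(a,b)=(a,b)$ if $a\notin\{k,k+1\}$, $\mathrm{symGE}(\sigma_k)(k,b)=(k+1,b+1)$, $\mathrm{symGE}(\sigma_k)(k+1,b)=(k,b+1)$, for $1\le k\le n-1$ and $a,b\in\mathbb{Z}$. *)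

theory Defs
  imports "HOL-Algebra.Bij" "HOL-Algebra.Coset"
begin

section \<open>Groups given by generators and relations\<close>

text \<open>A letter \<open>(s, True)\<close> stands for the generator \<open>s\<close>, and \<open>(s, False)\<close> for its formal inverse.
  A pair \<open>(r, r')\<close> of words in \<open>R\<close> stands for the relation \<open>r = r'\<close>.\<close>

type_synonym 'a word = "('a \<times> bool) list"

abbreviation words_over :: "'a set \<Rightarrow> 'a word set" where
  "words_over S \<equiv> lists (S \<times> UNIV)"

inductive_set word_cong :: "'a set \<Rightarrow> ('a word \<times> 'a word) set \<Rightarrow> ('a word \<times> 'a word) set"
  for S R where
  refl: "w \<in> words_over S \<Longrightarrow> (w, w) \<in> word_cong S R"
| sym: "(v, w) \<in> word_cong S R \<Longrightarrow> (w, v) \<in> word_cong S R"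
| trans: "(u, v) \<in> word_cong S R \<Longrightarrow> (v, w) \<in> word_cong S R \<Longrightarrow> (u, w) \<in> word_cong S R"
| cancel: "u \<in> words_over S \<Longrightarrow> v \<in> words_over S \<Longrightarrow> s \<in> S
    \<Longrightarrow> (u @ [(s, e), (s, \<not> e)] @ v, u @ v) \<in> word_cong S R"
| relation: "u \<in> words_over S \<Longrightarrow> v \<in> words_over S \<Longrightarrow> (r, r') \<in> R
    \<Longrightarrow> r \<in> words_over S \<Longrightarrow> r' \<in> words_over S
    \<Longrightarrow> (u @ r @ v, u @ r' @ v) \<in> word_cong S R"

definition word_class :: "'a set \<Rightarrow> ('a word \<times> 'a word) set \<Rightarrow> 'a word \<Rightarrow> 'a word set" where
  "word_class S R w = word_cong S R `` {w}"

definition presented_group :: "'a set \<Rightarrow> ('a word \<times> 'a word) set \<Rightarrow> 'a word set monoid" where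
  "presented_group S R =
    \<lparr>carrier = words_over S // word_cong S R,
     mult = (\<lambda>A B. \<Union>v\<in>A. \<Union>w\<in>B. word_class S R (v @ w)),
     one = word_class S R []\<rparr>"

fun word_eval :: "('b, 'm) monoid_scheme \<Rightarrow> ('a \<Rightarrow> 'b) \<Rightarrow> 'a word \<Rightarrow> 'b" where
  "word_eval H f [] = \<one>\<^bsub>H\<^esub>"
| "word_eval H f ((s, e) # w) = (if e then f s else inv\<^bsub>H\<^esub> f s) \<otimes>\<^bsub>H\<^esub> word_eval H f w"

text \<open>The homomorphism determined by the images \<open>f s\<close> of the generators. It is meaningful when \<open>f\<close>
  respects the relations, so that \<open>word_eval H f\<close> is constant on each class
  (\<open>presented_hom_hom\<close>, \<open>presented_hom_gen\<close>, \<open>presented_hom_unique\<close>).\<close>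

definition presented_hom ::
  "'a set \<Rightarrow> ('a word \<times> 'a word) set \<Rightarrow> ('b, 'm) monoid_scheme \<Rightarrow> ('a \<Rightarrow> 'b) \<Rightarrow> 'a word set \<Rightarrow> 'b" where
  "presented_hom S R H f = (\<lambda>A \<in> carrier (presented_group S R). the_elem (word_eval H f ` A))"

lemma word_cong_words: "(v, w) \<in> word_cong S R \<Longrightarrow> v \<in> words_over S \<and> w \<in> words_over S"
  by (induction rule: word_cong.induct) auto

lemma equiv_word_cong: "equiv (words_over S) (word_cong S R)"
proof (rule equivI)
  show "word_cong S R \<subseteq> words_over S \<times> words_over S"
  proof (rule subrelI)
    fix v w assume "(v, w) \<in> word_cong S R"
    from word_cong_words[OF this]
    show "(v, w) \<in> words_over S \<times> words_over S" by (simp only: mem_Sigma_iff)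
  qed
  show "refl_on (words_over S) (word_cong S R)"
    by (rule refl_onI) (rule word_cong.refl)
  show "sym (word_cong S R)" by (rule symI) (rule word_cong.sym)
  show "trans (word_cong S R)" by (rule transI) (rule word_cong.trans)
qed

lemma word_cong_context:
  assumes "(v, w) \<in> word_cong S R" "x \<in> words_over S" "y \<in> words_over S"
  shows "(x @ v @ y, x @ w @ y) \<in> word_cong S R"
  using assms
proof (induction rule: word_cong.induct)
  case (refl w)
  then show ?case by (intro word_cong.refl) auto
next
  case (sym v w)
  then show ?case by (blast intro: word_cong.sym)
next
  case (trans u v w)
  then show ?case by (blast intro: word_cong.trans)
next
  case (cancel u v s e)
  then show ?case using word_cong.cancel[of "x @ u" S "v @ y" s e R] by simp
next
  case (relation u v r r')
  then show ?case using word_cong.relation[of "x @ u" S "v @ y" r r' R] by simp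
qed

lemma word_cong_append:
  assumes "(v, v') \<in> word_cong S R" "(w, w') \<in> word_cong S R"
  shows "(v @ w, v' @ w') \<in> word_cong S R"
proof -
  have "(v @ w, v' @ w) \<in> word_cong S R"
    using word_cong_context[OF assms(1), of "[]" w] word_cong_words[OF assms(2)] by simp
  moreover have "(v' @ w, v' @ w') \<in> word_cong S R"
    using word_cong_context[OF assms(2), of v' "[]"] word_cong_words[OF assms(1)] by simp
  ultimately show ?thesis by (rule word_cong.trans)
qed

lemma word_class_eq_iff:
  assumes "v \<in> words_over S" "w \<in> words_over S"
  shows "word_class S R v = word_class S R w \<longleftrightarrow> (v, w) \<in> word_cong S R"
  unfolding word_class_def using eq_equiv_class_iff[OF equiv_word_cong assms] .

lemma word_class_eqI: "(v, w) \<in> word_cong S R \<Longrightarrow> word_class S R v = word_class S R w"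
  unfolding word_class_def by (rule equiv_class_eq[OF equiv_word_cong])

lemma word_class_self: "w \<in> words_over S \<Longrightarrow> w \<in> word_class S R w"
  by (simp add: word_class_def word_cong.refl)

lemma carrier_presented_group: "carrier (presented_group S R) = word_class S R ` words_over S"
  by (auto simp: presented_group_def quotient_def word_class_def)

lemma presented_groupE:
  assumes "x \<in> carrier (presented_group S R)"
  obtains w where "w \<in> words_over S" "x = word_class S R w"
  using assms unfolding carrier_presented_group by (rule imageE) (rule that)

lemma word_class_carrier: "w \<in> words_over S \<Longrightarrow> word_class S R w \<in> carrier (presented_group S R)"
  unfolding carrier_presented_group by (rule imageI)

lemma one_presented_group: "\<one>\<^bsub>presented_group S R\<^esub> = word_class S R []"
  by (simp add: presented_group_def)

lemma mult_word_class:
  assumes "v \<in> words_over S" "w \<in> words_over S"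
  shows "word_class S R v \<otimes>\<^bsub>presented_group S R\<^esub> word_class S R w = word_class S R (v @ w)"
proof -
  have "word_class S R (v' @ w') = word_class S R (v @ w)"
    if "v' \<in> word_class S R v" "w' \<in> word_class S R w" for v' w'
  proof -
    have "(v @ w, v' @ w') \<in> word_cong S R"
      using that unfolding word_class_def by (intro word_cong_append) simp_all
    then show ?thesis by (rule word_class_eqI[symmetric])
  qed
  moreover have "v \<in> word_class S R v" "w \<in> word_class S R w"
    by (rule word_class_self[OF assms(1)], rule word_class_self[OF assms(2)])
  ultimately have "(\<Union>v'\<in>word_class S R v. \<Union>w'\<in>word_class S R w. word_class S R (v' @ w'))
      = word_class S R (v @ w)"
    by blast
  then show ?thesis by (simp add: presented_group_def)
qed

lemma inverse_word_words:
  "w \<in> words_over S \<Longrightarrow> rev (map (\<lambda>(s, e). (s, \<not> e)) w) \<in> words_over S"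
  by (auto simp: in_lists_conv_set)

lemma word_cong_inverse:
  assumes "w \<in> words_over S"
  shows "(rev (map (\<lambda>(s, e). (s, \<not> e)) w) @ w, []) \<in> word_cong S R"
  using assms
proof (induction w rule: list.induct)
  case Nil
  then show ?case by (simp add: word_cong.refl)
next
  case (Cons l w)
  obtain s e where l: "l = (s, e)" by (cases l)
  let ?i = "rev (map (\<lambda>(s, e). (s, \<not> e)) w)"
  have *: "?i \<in> words_over S" using Cons.prems inverse_word_words[of w S] by simp
  have "(?i @ [(s, \<not> e), (s, \<not> \<not> e)] @ w, ?i @ w) \<in> word_cong S R"
    using Cons.prems * l by (intro word_cong.cancel) auto
  moreover have "(?i @ w, []) \<in> word_cong S R" using Cons by auto
  ultimately show ?case using l by (auto intro: word_cong.trans)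
qed

theorem group_presented_group: "group (presented_group S R)"
proof (rule groupI)
  fix x assume "x \<in> carrier (presented_group S R)"
  then obtain w where w: "w \<in> words_over S" "x = word_class S R w"
    by (rule presented_groupE)
  let ?i = "rev (map (\<lambda>(s, e). (s, \<not> e)) w)"
  have *: "?i \<in> words_over S" by (rule inverse_word_words[OF w(1)])
  have "word_class S R (?i @ w) = word_class S R []"
    by (intro word_class_eqI word_cong_inverse w)
  then have "word_class S R ?i \<otimes>\<^bsub>presented_group S R\<^esub> x = \<one>\<^bsub>presented_group S R\<^esub>"
    unfolding w(2) mult_word_class[OF * w(1)] one_presented_group .
  then show "\<exists>y\<in>carrier (presented_group S R).
      y \<otimes>\<^bsub>presented_group S R\<^esub> x = \<one>\<^bsub>presented_group S R\<^esub>"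
    using word_class_carrier[OF *] by (rule bexI)
  show "\<one>\<^bsub>presented_group S R\<^esub> \<otimes>\<^bsub>presented_group S R\<^esub> x = x"
    unfolding w(2) one_presented_group mult_word_class[OF lists.Nil w(1)] by (simp only: append_Nil)
next
  fix x y assume x: "x \<in> carrier (presented_group S R)" and y: "y \<in> carrier (presented_group S R)"
  from x obtain u where u: "u \<in> words_over S" "x = word_class S R u" by (rule presented_groupE)
  from y obtain v where v: "v \<in> words_over S" "y = word_class S R v" by (rule presented_groupE)
  have uv: "u @ v \<in> words_over S"
    by (rule append_in_lists_conv[THEN iffD2, OF conjI[OF u(1) v(1)]])
  show "x \<otimes>\<^bsub>presented_group S R\<^esub> y \<in> carrier (presented_group S R)"
    unfolding u(2) v(2) mult_word_class[OF u(1) v(1)] by (rule word_class_carrier[OF uv])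
  fix z assume z: "z \<in> carrier (presented_group S R)"
  from z obtain w where w: "w \<in> words_over S" "z = word_class S R w" by (rule presented_groupE)
  have vw: "v @ w \<in> words_over S"
    by (rule append_in_lists_conv[THEN iffD2, OF conjI[OF v(1) w(1)]])
  show "x \<otimes>\<^bsub>presented_group S R\<^esub> y \<otimes>\<^bsub>presented_group S R\<^esub> z
      = x \<otimes>\<^bsub>presented_group S R\<^esub> (y \<otimes>\<^bsub>presented_group S R\<^esub> z)"
    unfolding u(2) v(2) w(2) mult_word_class[OF u(1) v(1)] mult_word_class[OF v(1) w(1)]
      mult_word_class[OF uv w(1)] mult_word_class[OF u(1) vw] by (simp only: append_assoc)
next
  show "\<one>\<^bsub>presented_group S R\<^esub> \<in> carrier (presented_group S R)"
    unfolding one_presented_group by (intro word_class_carrier lists.Nil)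
qed

lemma Cons_words_over:
  "(s, e) # w \<in> words_over S \<longleftrightarrow> s \<in> S \<and> w \<in> words_over S"
  unfolding Cons_in_lists_iff by (simp only: mem_Sigma_iff UNIV_I simp_thms)

lemma append_words_over: "u \<in> words_over S \<Longrightarrow> v \<in> words_over S \<Longrightarrow> u @ v \<in> words_over S"
  unfolding append_in_lists_conv by (rule conjI)

lemma (in group) word_eval_closed:
  assumes f: "f \<in> S \<rightarrow> carrier G" and w: "w \<in> words_over S"
  shows "word_eval G f w \<in> carrier G"
  using w
proof (induction w rule: list.induct)
  case Nil
  show ?case unfolding word_eval.simps by (rule one_closed)
next
  case (Cons l w)
  obtain s e where l: "l = (s, e)" by (rule prod.exhaust)
  have s: "s \<in> S" and w: "w \<in> words_over S" using Cons.prems unfolding l Cons_words_over by blast+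
  have "f s \<in> carrier G" using f s by (rule funcset_mem)
  then show ?case using Cons.IH[OF w] unfolding l by simp
qed

lemma (in group) word_eval_append:
  assumes f: "f \<in> S \<rightarrow> carrier G" and v: "v \<in> words_over S" and w: "w \<in> words_over S"
  shows "word_eval G f (v @ w) = word_eval G f v \<otimes> word_eval G f w"
  using v
proof (induction v rule: list.induct)
  case Nil
  show ?case using word_eval_closed[OF f w] by simp
next
  case (Cons l v)
  obtain s e where l: "l = (s, e)" by (rule prod.exhaust)
  have s: "s \<in> S" and v: "v \<in> words_over S" using Cons.prems unfolding l Cons_words_over by blast+
  have "f s \<in> carrier G" using f s by (rule funcset_mem)
  then show ?case
    using Cons.IH[OF v] word_eval_closed[OF f v] word_eval_closed[OF f w] unfolding l
    by (simp add: m_assoc)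
qed

lemma (in group) word_eval_cong:
  assumes f: "f \<in> S \<rightarrow> carrier G"
    and R: "\<And>r r'. (r, r') \<in> R \<Longrightarrow> r \<in> words_over S \<Longrightarrow> r' \<in> words_over S
      \<Longrightarrow> word_eval G f r = word_eval G f r'"
    and vw: "(v, w) \<in> word_cong S R"
  shows "word_eval G f v = word_eval G f w"
  using vw
proof (induction rule: word_cong.induct)
  case (cancel u v s e)
  have "f s \<in> carrier G" using f cancel(3) by (rule funcset_mem)
  then have *: "word_eval G f ([(s, e), (s, \<not> e)] @ v) = word_eval G f v"
    using word_eval_closed[OF f cancel(2)] by (cases e) (simp_all flip: m_assoc)
  have "[(s, e), (s, \<not> e)] @ v \<in> words_over S"
    using cancel(2,3) by (simp only: append_Cons append_Nil Cons_words_over simp_thms)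
  then show ?case
    by (simp only: word_eval_append[OF f cancel(1)] * cancel(2))
next
  case (relation u v r r')
  show ?case
    by (simp only: word_eval_append[OF f] append_words_over relation R[OF relation(3-5)])
qed simp_all

lemma (in group) presented_hom_class:
  assumes f: "f \<in> S \<rightarrow> carrier G"
    and R: "\<And>r r'. (r, r') \<in> R \<Longrightarrow> r \<in> words_over S \<Longrightarrow> r' \<in> words_over S
      \<Longrightarrow> word_eval G f r = word_eval G f r'"
    and w: "w \<in> words_over S"
  shows "presented_hom S R G f (word_class S R w) = word_eval G f w"
proof -
  have "word_eval G f v = word_eval G f w" if "v \<in> word_class S R w" for v
  proof -
    have "(w, v) \<in> word_cong S R" using that unfolding word_class_def by (rule ImageE) simp
    from word_eval_cong[OF f R this] show ?thesis by simp
  qed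
  then have "word_eval G f ` word_class S R w = {word_eval G f w}"
    using word_class_self[OF w, of R] by blast
  then show ?thesis using word_class_carrier[OF w, of R] by (simp add: presented_hom_def)
qed

theorem (in group) presented_hom_hom:
  assumes f: "f \<in> S \<rightarrow> carrier G"
    and R: "\<And>r r'. (r, r') \<in> R \<Longrightarrow> r \<in> words_over S \<Longrightarrow> r' \<in> words_over S
      \<Longrightarrow> word_eval G f r = word_eval G f r'"
  shows "presented_hom S R G f \<in> hom (presented_group S R) G"
proof (rule homI)
  fix x assume "x \<in> carrier (presented_group S R)"
  then obtain v where v: "v \<in> words_over S" "x = word_class S R v" by (rule presented_groupE)
  have x: "presented_hom S R G f x = word_eval G f v"
    unfolding v(2) by (rule presented_hom_class[OF f R v(1)])
  show "presented_hom S R G f x \<in> carrier G"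
    unfolding x by (rule word_eval_closed[OF f v(1)])
  fix y assume "y \<in> carrier (presented_group S R)"
  then obtain w where w: "w \<in> words_over S" "y = word_class S R w" by (rule presented_groupE)
  have y: "presented_hom S R G f y = word_eval G f w"
    unfolding w(2) by (rule presented_hom_class[OF f R w(1)])
  have "presented_hom S R G f (x \<otimes>\<^bsub>presented_group S R\<^esub> y) = word_eval G f (v @ w)"
    unfolding v(2) w(2) mult_word_class[OF v(1) w(1)]
    by (rule presented_hom_class[OF f R append_words_over[OF v(1) w(1)]])
  then show "presented_hom S R G f (x \<otimes>\<^bsub>presented_group S R\<^esub> y)
      = presented_hom S R G f x \<otimes> presented_hom S R G f y"
    unfolding x y word_eval_append[OF f v(1) w(1)] .
qed

theorem (in group) presented_hom_gen:
  assumes f: "f \<in> S \<rightarrow> carrier G"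
    and R: "\<And>r r'. (r, r') \<in> R \<Longrightarrow> r \<in> words_over S \<Longrightarrow> r' \<in> words_over S
      \<Longrightarrow> word_eval G f r = word_eval G f r'"
    and s: "s \<in> S"
  shows "presented_hom S R G f (word_class S R [(s, True)]) = f s"
proof -
  have "[(s, True)] \<in> words_over S" using s unfolding Cons_words_over by simp
  from presented_hom_class[OF f R this]
  have "presented_hom S R G f (word_class S R [(s, True)]) = word_eval G f [(s, True)]" .
  also have "\<dots> = f s" using funcset_mem[OF f s] by simp
  finally show ?thesis .
qed

theorem (in group) presented_hom_unique:
  assumes f: "f \<in> S \<rightarrow> carrier G"
    and R: "\<And>r r'. (r, r') \<in> R \<Longrightarrow> r \<in> words_over S \<Longrightarrow> r' \<in> words_over S
      \<Longrightarrow> word_eval G f r = word_eval G f r'"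
    and h: "h \<in> hom (presented_group S R) G"
    and gen: "\<And>s. s \<in> S \<Longrightarrow> h (word_class S R [(s, True)]) = f s"
    and x: "x \<in> carrier (presented_group S R)"
  shows "h x = presented_hom S R G f x"
proof -
  interpret P: group "presented_group S R" by (rule group_presented_group)
  interpret h: group_hom "presented_group S R" G h
    by unfold_locales (rule h)
  have wc: "[(s, e)] \<in> words_over S" if "s \<in> S" for s e
    using that unfolding Cons_words_over by simp
  have letter: "h (word_class S R [(s, e)]) = (if e then f s else inv f s)" if s: "s \<in> S" for s e
  proof (cases e)
    case True
    then show ?thesis using gen[OF s] by simp
  next
    case False
    have "([(s, False), (s, True)], []) \<in> word_cong S R"
      using word_cong.cancel[OF lists.Nil lists.Nil s, of False R] by simp
    then have "word_class S R [(s, False), (s, True)] = word_class S R []"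
      by (rule word_class_eqI)
    then have "word_class S R [(s, False)] \<otimes>\<^bsub>presented_group S R\<^esub> word_class S R [(s, True)]
        = \<one>\<^bsub>presented_group S R\<^esub>"
      unfolding mult_word_class[OF wc[OF s] wc[OF s]] by (simp add: one_presented_group)
    then have "inv\<^bsub>presented_group S R\<^esub> word_class S R [(s, True)] = word_class S R [(s, False)]"
      by (rule P.inv_equality) (intro word_class_carrier wc s)+
    then have "h (word_class S R [(s, False)]) = inv f s"
      using h.hom_inv[OF word_class_carrier[OF wc[OF s, of True]]] gen[OF s] by simp
    then show ?thesis using False by simp
  qed
  have *: "h (word_class S R w) = word_eval G f w" if w: "w \<in> words_over S" for w
    using w
  proof (induction w rule: list.induct)
    case Nil
    show ?case using h.hom_one unfolding one_presented_group by simp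
  next
    case (Cons l w)
    obtain s e where l: "l = (s, e)" by (rule prod.exhaust)
    have s: "s \<in> S" and w: "w \<in> words_over S"
      using Cons.prems unfolding l Cons_words_over by blast+
    have "word_class S R (l # w)
        = word_class S R [(s, e)] \<otimes>\<^bsub>presented_group S R\<^esub> word_class S R w"
      unfolding mult_word_class[OF wc[OF s] w] l by simp
    then show ?case
      using h.hom_mult[OF word_class_carrier[OF wc[OF s, of e]] word_class_carrier[OF w]]
        Cons.IH[OF w] letter[OF s, of e] l by simp
  qed
  from x obtain w where w: "w \<in> words_over S" "x = word_class S R w" by (rule presented_groupE)
  show ?thesis
    unfolding w(2) *[OF w(1)] by (rule presented_hom_class[OF f R w(1), symmetric])
qed

section \<open>The braid group\<close>

definition braid_relations :: "nat \<Rightarrow> (nat word \<times> nat word) set" where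
  "braid_relations n =
     {([(i, True), (i + 1, True), (i, True)], [(i + 1, True), (i, True), (i + 1, True)]) | i.
        i \<in> {1..n - 2}} \<union>
     {([(i, True), (j, True)], [(j, True), (i, True)]) | i j.
        i \<in> {1..n - 1} \<and> j \<in> {1..n - 1} \<and> \<bar>int i - int j\<bar> > 1}"

definition braid_group :: "nat \<Rightarrow> nat word set monoid" where
  "braid_group n = presented_group {1..n - 1} (braid_relations n)"

definition artin_gen :: "nat \<Rightarrow> nat \<Rightarrow> nat word set" where
  "artin_gen n k = word_class {1..n - 1} (braid_relations n) [(k, True)]"

lemma group_braid_group: "group (braid_group n)"
  by (simp add: braid_group_def group_presented_group)

section \<open>The Gauss-Epple action and its symmetric version\<close>

text \<open>\<open>BijGroup X\<close> is the group of bijections of \<open>X\<close> under composition, represented by functions that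
  are \<open>undefined\<close> outside \<open>X\<close>; this is why the functions below are restricted.\<close>

definition GE_gen :: "nat \<Rightarrow> nat \<Rightarrow> int \<times> int \<Rightarrow> int \<times> int" where
  "GE_gen n k = (\<lambda>(a, b) \<in> {1..int n} \<times> UNIV.
     if a = int k then (int k + 1, b)
     else if a = int k + 1 then (int k, b + 1)
     else (a, b))"

definition symGE_gen :: "nat \<Rightarrow> int \<times> int \<Rightarrow> int \<times> int" where
  "symGE_gen k = (\<lambda>(a, b).
     if a = int k then (int k + 1, b + 1)
     else if a = int k + 1 then (int k, b + 1)
     else (a, b))"

definition GE :: "nat \<Rightarrow> nat word set \<Rightarrow> int \<times> int \<Rightarrow> int \<times> int" where
  "GE n = presented_hom {1..n - 1} (braid_relations n) (BijGroup ({1..int n} \<times> UNIV)) (GE_gen n)"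

definition symGE :: "nat \<Rightarrow> nat word set \<Rightarrow> int \<times> int \<Rightarrow> int \<times> int" where
  "symGE n = presented_hom {1..n - 1} (braid_relations n) (BijGroup UNIV) symGE_gen"

lemma mult_BijGroup: "f \<in> Bij X \<Longrightarrow> g \<in> Bij X \<Longrightarrow> f \<otimes>\<^bsub>BijGroup X\<^esub> g = compose X f g"
  by (simp add: BijGroup_def)

lemma carrier_BijGroup: "carrier (BijGroup X) = Bij X"
  by (simp add: BijGroup_def)

lemma one_BijGroup: "\<one>\<^bsub>BijGroup X\<^esub> = (\<lambda>x\<in>X. x)"
  by (simp add: BijGroup_def)

lemma GE_gen_Bij:
  assumes "k \<in> {1..n - 1}"
  shows "GE_gen n k \<in> Bij ({1..int n} \<times> UNIV)"
proof -
  let ?X = "{1..int n} \<times> (UNIV :: int set)"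
  let ?g = "\<lambda>(a, b). if a = int k + 1 then (int k, b)
     else if a = int k then (int k + 1, b - 1) else (a, b)"
  have "bij_betw (GE_gen n k) ?X ?X"
    by (rule bij_betw_byWitness[where f' = ?g])
      (use assms in \<open>auto simp: GE_gen_def split: if_splits\<close>)
  moreover have "GE_gen n k \<in> extensional ?X" by (simp add: GE_gen_def)
  ultimately show ?thesis by (simp add: Bij_def)
qed

lemma symGE_gen_Bij: "symGE_gen k \<in> Bij UNIV"
proof -
  let ?g = "\<lambda>(a, b). if a = int k + 1 then (int k, b - 1)
     else if a = int k then (int k + 1, b - 1) else (a, b)"
  have "bij_betw (symGE_gen k) UNIV UNIV"
    by (rule bij_betw_byWitness[where f' = ?g]) (auto simp: symGE_gen_def split: if_splits)
  then show ?thesis by (simp add: Bij_def)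
qed

lemma GE_gen_relations:
  assumes "(r, r') \<in> braid_relations n"
    "r \<in> words_over {1..n - 1}" "r' \<in> words_over {1..n - 1}"
  shows "word_eval (BijGroup ({1..int n} \<times> UNIV)) (GE_gen n) r
    = word_eval (BijGroup ({1..int n} \<times> UNIV)) (GE_gen n) r'"
proof -
  let ?X = "{1..int n} \<times> UNIV :: (int \<times> int) set"
  let ?f = "GE_gen n"
  have B: "?f k \<in> Bij ?X" if "k \<in> {1..n - 1}" for k
    using that by (rule GE_gen_Bij)
  have id: "compose ?X (?f k) (\<lambda>x\<in>?X. x) = ?f k" if "k \<in> {1..n - 1}" for k
    by (rule compose_Id[OF Bij_imp_funcset[OF B[OF that]] Bij_imp_extensional[OF B[OF that]]])
  have pair: "word_eval (BijGroup ?X) ?f [(i, True), (j, True)] = compose ?X (?f i) (?f j)"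
    if "i \<in> {1..n - 1}" "j \<in> {1..n - 1}" for i j
    using B[OF that(1)] B[OF that(2)] id[OF that(1)] id[OF that(2)]
    by (simp add: mult_BijGroup one_BijGroup id_Bij compose_Bij)
  have triple: "word_eval (BijGroup ?X) ?f [(i, True), (j, True), (i, True)]
      = compose ?X (?f i) (compose ?X (?f j) (?f i))"
    if "i \<in> {1..n - 1}" "j \<in> {1..n - 1}" for i j
    using B[OF that(1)] B[OF that(2)] id[OF that(1)] id[OF that(2)]
    by (simp add: mult_BijGroup one_BijGroup id_Bij compose_Bij)
  from assms(1) consider
    (braid) i where "i \<in> {1..n - 2}" "r = [(i, True), (i + 1, True), (i, True)]"
      "r' = [(i + 1, True), (i, True), (i + 1, True)]"
  | (comm) i j where "i \<in> {1..n - 1}" "j \<in> {1..n - 1}" "\<bar>int i - int j\<bar> > 1"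
      "r = [(i, True), (j, True)]" "r' = [(j, True), (i, True)]"
    unfolding braid_relations_def by blast
  then show ?thesis
  proof cases
    case braid
    have i: "i \<in> {1..n - 1}" "i + 1 \<in> {1..n - 1}" using braid(1) by auto
    have "compose ?X (?f i) (compose ?X (?f (i + 1)) (?f i))
        = compose ?X (?f (i + 1)) (compose ?X (?f i) (?f (i + 1)))"
      using i by (auto simp: compose_def GE_gen_def fun_eq_iff)
    then show ?thesis unfolding braid(2,3) triple[OF i] triple[OF i(2,1)] .
  next
    case comm
    have "compose ?X (?f i) (?f j) = compose ?X (?f j) (?f i)"
      using comm(1-3) by (auto simp: compose_def GE_gen_def fun_eq_iff)
    then show ?thesis unfolding comm(4,5) pair[OF comm(1,2)] pair[OF comm(2,1)] .
  qed
qed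

lemma symGE_gen_relations:
  assumes "(r, r') \<in> braid_relations n"
    "r \<in> words_over {1..n - 1}" "r' \<in> words_over {1..n - 1}"
  shows "word_eval (BijGroup UNIV) symGE_gen r = word_eval (BijGroup UNIV) symGE_gen r'"
proof -
  let ?X = "UNIV :: (int \<times> int) set"
  let ?f = "symGE_gen"
  have B: "?f k \<in> Bij ?X" for k
    by (rule symGE_gen_Bij)
  have id: "compose ?X (?f k) (\<lambda>x\<in>?X. x) = ?f k" for k
    by (rule compose_Id[OF Bij_imp_funcset[OF B] Bij_imp_extensional[OF B]])
  have pair: "word_eval (BijGroup ?X) ?f [(i, True), (j, True)] = compose ?X (?f i) (?f j)" for i j
    using B[of i] B[of j] id[of i] id[of j]
    by (simp add: mult_BijGroup one_BijGroup id_Bij compose_Bij)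
  have triple: "word_eval (BijGroup ?X) ?f [(i, True), (j, True), (i, True)]
      = compose ?X (?f i) (compose ?X (?f j) (?f i))" for i j
    using B[of i] B[of j] id[of i] id[of j]
    by (simp add: mult_BijGroup one_BijGroup id_Bij compose_Bij)
  from assms(1) consider
    (braid) i where "i \<in> {1..n - 2}" "r = [(i, True), (i + 1, True), (i, True)]"
      "r' = [(i + 1, True), (i, True), (i + 1, True)]"
  | (comm) i j where "i \<in> {1..n - 1}" "j \<in> {1..n - 1}" "\<bar>int i - int j\<bar> > 1"
      "r = [(i, True), (j, True)]" "r' = [(j, True), (i, True)]"
    unfolding braid_relations_def by blast
  then show ?thesis
  proof cases
    case braid
    have "compose ?X (?f i) (compose ?X (?f (i + 1)) (?f i))
        = compose ?X (?f (i + 1)) (compose ?X (?f i) (?f (i + 1)))"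
      by (auto simp: compose_def symGE_gen_def fun_eq_iff)
    then show ?thesis unfolding braid(2,3) triple .
  next
    case comm
    have "compose ?X (?f i) (?f j) = compose ?X (?f j) (?f i)"
      using comm(1-3) by (auto simp: compose_def symGE_gen_def fun_eq_iff)
    then show ?thesis unfolding comm(4,5) pair .
  qed
qed

lemma GE_hom: "GE n \<in> hom (braid_group n) (BijGroup ({1..int n} \<times> UNIV))"
  unfolding GE_def braid_group_def
  by (rule group.presented_hom_hom[OF group_BijGroup])
    (use GE_gen_Bij GE_gen_relations in \<open>auto simp: carrier_BijGroup\<close>)

lemma GE_artin_gen: "k \<in> {1..n - 1} \<Longrightarrow> GE n (artin_gen n k) = GE_gen n k"
  unfolding GE_def artin_gen_def
  by (rule group.presented_hom_gen[OF group_BijGroup])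
    (use GE_gen_Bij GE_gen_relations in \<open>auto simp: carrier_BijGroup\<close>)

lemma symGE_hom: "symGE n \<in> hom (braid_group n) (BijGroup UNIV)"
  unfolding symGE_def braid_group_def
  by (rule group.presented_hom_hom[OF group_BijGroup])
    (use symGE_gen_Bij symGE_gen_relations in \<open>auto simp: carrier_BijGroup\<close>)

lemma symGE_artin_gen: "k \<in> {1..n - 1} \<Longrightarrow> symGE n (artin_gen n k) = symGE_gen k"
  unfolding symGE_def artin_gen_def
  by (rule group.presented_hom_gen[OF group_BijGroup])
    (use symGE_gen_Bij symGE_gen_relations in \<open>auto simp: carrier_BijGroup\<close>)

end

theory Submission
  imports Defs
begin

text \<open>The injection \<open>(a, b) \<mapsto> (a, a + 2 b)\<close> of \<open>{1..n} \<times> \<int>\<close> into \<open>\<int> \<times> \<int>\<close> carries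
  the Gauss-Epple action to the symmetric one: adding the column number to the doubled height
  spreads the height increase of \<open>2\<close>, which the original generator puts on one of its two moves,
  evenly over both of them. So a braid that acts trivially by the symmetric action acts trivially
  by the original one.

  The image of the injection is the set of points \<open>(a, b)\<close> with \<open>1 \<le> a \<le> n\<close> and \<open>a + b\<close> even, so
  for the converse the points outside it have to be controlled. The symmetric action commutes with
  the vertical translation \<open>(a, b) \<mapsto> (a, b + 1)\<close>, which exchanges the two parities, and it fixes
  every point with \<open>a \<notin> {1..n}\<close>.

  All three facts about the symmetric action (equivariance of the injection, commutation with the
  translation, fixed points) say that some map intertwines two actions, and this needs to be checked
  on generators only (\<open>word_eval_intertwine\<close>).\<close>

lemma BijGroup_inv_apply_eq:
  assumes "g \<in> Bij X" "y \<in> X" "g y = x"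
  shows "(inv\<^bsub>BijGroup X\<^esub> g) x = y"
proof -
  have "inj_on g X" "x \<in> X"
    using assms Bij_imp_funcset[OF assms(1)] by (auto simp: Bij_def bij_betw_def)
  then show ?thesis
    using assms by (auto simp: inv_BijGroup)
qed

lemma BijGroup_inv_apply:
  assumes "g \<in> Bij X" "x \<in> X"
  shows "(inv\<^bsub>BijGroup X\<^esub> g) x \<in> X" "g ((inv\<^bsub>BijGroup X\<^esub> g) x) = x"
proof -
  have "x \<in> g ` X"
    using assms by (simp add: Bij_def bij_betw_def)
  then obtain y where "y \<in> X" "g y = x" by blast
  then show "(inv\<^bsub>BijGroup X\<^esub> g) x \<in> X" "g ((inv\<^bsub>BijGroup X\<^esub> g) x) = x"
    using BijGroup_inv_apply_eq[OF assms(1)] by simp_all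
qed

lemma word_eval_Bij:
  assumes "\<And>s. s \<in> S \<Longrightarrow> g s \<in> Bij X" "w \<in> words_over S"
  shows "word_eval (BijGroup X) g w \<in> Bij X"
  using group.word_eval_closed[OF group_BijGroup _ assms(2), of g X] assms(1)
  by (auto simp: carrier_BijGroup)

text \<open>A map that is equivariant for the generators is equivariant for their inverses:
  apply the intertwining relation at \<open>g s\<inverse> x\<close>. Words then follow by induction.\<close>

lemma word_eval_intertwine:
  assumes g: "\<And>s. s \<in> S \<Longrightarrow> g s \<in> Bij X"
    and h: "\<And>s. s \<in> S \<Longrightarrow> h s \<in> Bij Y"
    and f: "\<And>x. x \<in> X \<Longrightarrow> f x \<in> Y"
    and fgh: "\<And>s x. s \<in> S \<Longrightarrow> x \<in> X \<Longrightarrow> f (g s x) = h s (f x)"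
    and w: "w \<in> words_over S" and x: "x \<in> X"
  shows "f (word_eval (BijGroup X) g w x) = word_eval (BijGroup Y) h w (f x)"
  using w
proof (induction w rule: list.induct)
  case Nil
  show ?case using x f[OF x] by (simp add: one_BijGroup)
next
  case (Cons l w)
  obtain s e where l: "l = (s, e)" by (rule prod.exhaust)
  have s: "s \<in> S" and w: "w \<in> words_over S"
    using Cons.prems unfolding l Cons_words_over by blast+
  let ?u = "word_eval (BijGroup X) g w" and ?v = "word_eval (BijGroup Y) h w"
  let ?g = "if e then g s else inv\<^bsub>BijGroup X\<^esub> g s"
  let ?h = "if e then h s else inv\<^bsub>BijGroup Y\<^esub> h s"
  have u: "?u \<in> Bij X" and v: "?v \<in> Bij Y"
    by (rule word_eval_Bij[OF _ w], erule g, rule word_eval_Bij[OF _ w], erule h)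
  have g': "?g \<in> Bij X" and h': "?h \<in> Bij Y"
    using g[OF s] h[OF s] group.inv_closed[OF group_BijGroup, of "g s" X]
      group.inv_closed[OF group_BijGroup, of "h s" Y]
    by (simp_all add: carrier_BijGroup)
  have ux: "?u x \<in> X" using Bij_imp_funcset[OF u] x by blast
  have "f (?g (?u x)) = ?h (f (?u x))"
  proof (cases e)
    case True
    then show ?thesis using fgh[OF s ux] by simp
  next
    case False
    let ?y = "(inv\<^bsub>BijGroup X\<^esub> g s) (?u x)"
    have y: "?y \<in> X" "g s ?y = ?u x"
      by (rule BijGroup_inv_apply[OF g[OF s] ux])+
    have "h s (f ?y) = f (?u x)" using fgh[OF s y(1)] y(2) by simp
    from BijGroup_inv_apply_eq[OF h[OF s] f[OF y(1)] this]
    show ?thesis using False by simp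
  qed
  then show ?case
    using Cons.IH[OF w] x f[OF x]
    by (simp add: l mult_BijGroup[OF g' u] mult_BijGroup[OF h' v] compose_eq del: if_split)
qed

text \<open>A common fixed point of the generators is an orbit on its own, and the only bijection of a
  singleton is the identity. So this is the case of the inclusion of a singleton.\<close>

lemma word_eval_fixed_point:
  assumes h: "\<And>s. s \<in> S \<Longrightarrow> h s \<in> Bij Y" and p: "p \<in> Y"
    and fixed: "\<And>s. s \<in> S \<Longrightarrow> h s p = p" and w: "w \<in> words_over S"
  shows "word_eval (BijGroup Y) h w p = p"
proof -
  let ?g = "\<lambda>_. \<lambda>x\<in>{p}. x"
  have g: "?g s \<in> Bij {p}" for s by (rule id_Bij)
  have "word_eval (BijGroup {p}) ?g w p = word_eval (BijGroup Y) h w p"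
    by (rule word_eval_intertwine[where f = "\<lambda>x. x" and S = S])
      (use g h fixed p w in auto)
  moreover have "word_eval (BijGroup {p}) ?g w p \<in> {p}"
    by (rule funcset_mem[OF Bij_imp_funcset[OF word_eval_Bij[OF _ w]]]) (use g in simp_all)
  ultimately show ?thesis by simp
qed

definition parity_embedding :: "int \<times> int \<Rightarrow> int \<times> int" where
  "parity_embedding = (\<lambda>(a, b). (a, a + 2 * b))"

lemma inj_parity_embedding: "inj parity_embedding"
  by (auto simp: inj_def parity_embedding_def)

lemma parity_embedding_GE_gen:
  assumes "p \<in> {1..int n} \<times> UNIV"
  shows "parity_embedding (GE_gen n k p) = symGE_gen k (parity_embedding p)"
  using assms by (auto simp: parity_embedding_def GE_gen_def symGE_gen_def)

lemma word_eval_symGE_parity_embedding: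
  assumes "w \<in> words_over {1..n - 1}" "p \<in> {1..int n} \<times> UNIV"
  shows "word_eval (BijGroup UNIV) symGE_gen w (parity_embedding p)
    = parity_embedding (word_eval (BijGroup ({1..int n} \<times> UNIV)) (GE_gen n) w p)"
  by (rule word_eval_intertwine[symmetric, where S = "{1..n - 1}"])
    (use assms GE_gen_Bij symGE_gen_Bij parity_embedding_GE_gen in auto)

lemma word_eval_symGE_translate:
  assumes "w \<in> words_over S"
  shows "word_eval (BijGroup UNIV) symGE_gen w (apsnd (\<lambda>b. b + 1) p)
    = apsnd (\<lambda>b. b + 1) (word_eval (BijGroup UNIV) symGE_gen w p)"
  by (rule word_eval_intertwine[symmetric, where S = S])
    (use assms symGE_gen_Bij in \<open>auto simp: symGE_gen_def split: prod.splits\<close>)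

lemma word_eval_symGE_outside:
  assumes "w \<in> words_over {1..n - 1}" "a \<notin> {1..int n}"
  shows "word_eval (BijGroup UNIV) symGE_gen w (a, b) = (a, b)"
  by (rule word_eval_fixed_point[where S = "{1..n - 1}"])
    (use assms symGE_gen_Bij in \<open>auto simp: symGE_gen_def\<close>)

lemma word_eval_symGE_trivial_iff:
  assumes w: "w \<in> words_over {1..n - 1}"
  shows "word_eval (BijGroup UNIV) symGE_gen w = \<one>\<^bsub>BijGroup UNIV\<^esub>
    \<longleftrightarrow> word_eval (BijGroup ({1..int n} \<times> UNIV)) (GE_gen n) w = \<one>\<^bsub>BijGroup ({1..int n} \<times> UNIV)\<^esub>"
    (is "?s = _ \<longleftrightarrow> ?g = \<one>\<^bsub>BijGroup ?X\<^esub>")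
proof
  assume s: "?s = \<one>\<^bsub>BijGroup UNIV\<^esub>"
  have "?g p = p" if "p \<in> ?X" for p
    using word_eval_symGE_parity_embedding[OF w that] injD[OF inj_parity_embedding, of "?g p" p]
    by (simp add: s one_BijGroup)
  moreover have "?g \<in> extensional ?X"
    by (rule Bij_imp_extensional[OF word_eval_Bij[OF _ w]]) (rule GE_gen_Bij)
  ultimately show "?g = \<one>\<^bsub>BijGroup ?X\<^esub>"
    by (auto simp: one_BijGroup intro!: extensionalityI[of _ ?X])
next
  assume g: "?g = \<one>\<^bsub>BijGroup ?X\<^esub>"
  have even: "?s (a, b) = (a, b)" if a: "a \<in> {1..int n}" and "even (a + b)" for a b
  proof -
    have "even (b - a)" using \<open>even (a + b)\<close> by simp
    then obtain c where "b - a = 2 * c" by (rule evenE)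
    then have ab: "(a, b) = parity_embedding (a, c)"
      by (simp add: parity_embedding_def)
    show ?thesis
      using word_eval_symGE_parity_embedding[OF w, of "(a, c)"] a unfolding ab
      by (simp add: g one_BijGroup)
  qed
  have "?s (a, b) = (a, b)" for a b
  proof -
    consider "a \<notin> {1..int n}" | "a \<in> {1..int n}" "even (a + b)"
      | "a \<in> {1..int n}" "even (a + (b - 1))"
      by fastforce
    then show ?thesis
    proof cases
      case 1
      then show ?thesis by (rule word_eval_symGE_outside[OF w])
    next
      case 2
      then show ?thesis by (rule even)
    next
      case 3
      then show ?thesis
        using word_eval_symGE_translate[OF w, of "(a, b - 1)"] even[OF 3] by simp
    qed
  qed
  then show "?s = \<one>\<^bsub>BijGroup UNIV\<^esub>"
    by (auto simp: one_BijGroup)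
qed

lemma symGE_word_class:
  assumes "w \<in> words_over {1..n - 1}"
  shows "symGE n (word_class {1..n - 1} (braid_relations n) w)
    = word_eval (BijGroup UNIV) symGE_gen w"
  unfolding symGE_def
  by (rule group.presented_hom_class[OF group_BijGroup])
    (use symGE_gen_Bij symGE_gen_relations assms in \<open>auto simp: carrier_BijGroup\<close>)

lemma GE_word_class:
  assumes "w \<in> words_over {1..n - 1}"
  shows "GE n (word_class {1..n - 1} (braid_relations n) w)
    = word_eval (BijGroup ({1..int n} \<times> UNIV)) (GE_gen n) w"
  unfolding GE_def
  by (rule group.presented_hom_class[OF group_BijGroup])
    (use GE_gen_Bij GE_gen_relations assms in \<open>auto simp: carrier_BijGroup\<close>)

theorem theorem3p2:
  fixes n :: nat
  assumes "n \<ge> 2"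
  shows "kernel (braid_group n) (BijGroup (UNIV :: (int \<times> int) set)) (symGE n)
    = kernel (braid_group n) (BijGroup ({1..int n} \<times> (UNIV :: int set))) (GE n)"
proof -
  have "symGE n x = \<one>\<^bsub>BijGroup UNIV\<^esub> \<longleftrightarrow> GE n x = \<one>\<^bsub>BijGroup ({1..int n} \<times> UNIV)\<^esub>"
    if "x \<in> carrier (braid_group n)" for x
  proof -
    from that obtain w where w: "w \<in> words_over {1..n - 1}"
      "x = word_class {1..n - 1} (braid_relations n) w"
      unfolding braid_group_def by (rule presented_groupE)
    show ?thesis
      unfolding w(2) symGE_word_class[OF w(1)] GE_word_class[OF w(1)]
      by (rule word_eval_symGE_trivial_iff[OF w(1)])
  qed
  then show ?thesis by (auto simp: kernel_def)
qed

end
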